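(* Let $X$ be a topological space of countable closed pseudocharacter, i.e. $\psi_c(X)\le\aleph_0$ (in particular, $X$ may be any first-countable Hausdorff space). If player two has a winning strategy in the game $G^{\omega_1}_1(\mathcal{O}_X,\overline{\mathcal{O}}_X)$, then $|X|\le 2^{\aleph_0}$.
   Context: For an ordinal $\alpha$ and collections of sets $\mathcal{A},\mathcal{B}$, $G^\alpha_1(\mathcal{A},\mathcal{B})$ denotes the two-player game of length $\alpha$ in which, at inning $\beta<\alpha$, player one chooses $\mathcal{U}_\beta\in\mathcal{A}$ and player two responds with an element $V_\beta\in\mathcal{U}_\beta$. Player two wins if and only if $\{V_\beta:\beta<\alpha\}\in\mathcal{B}$. For a topological space $X$: $\mathcal{O}_X$ is the set of all open covers of $X$, and $\overline{\mathcal{O}}_X$ is the collection of all families $\mathcal{U}$ of open subsets of $X$ such that $\{\overline{U}:U\in\mathcal{U}\}$ covers $X$. The closed pseudocharacter $\psi_c(X)$ is the least cardinal $\kappa$ such that for every $x\in X$ there is a family $\mathcal{V}$ of open neighbourhoods of $x$ with $|\mathcal{V}|\le\kappa$ and $\bigcap\{\overline{V}:V\in\mathcal{V}\}=\{x\}$. *)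

theory Defs
  imports "HOL-Analysis.Analysis"
begin

unbundle cardinal_syntax

definition open_covers :: "'a topology \<Rightarrow> 'a set set set" where
  "open_covers X = {\<U>. (\<forall>U\<in>\<U>. openin X U) \<and> \<Union>\<U> = topspace X}"

definition closure_covers :: "'a topology \<Rightarrow> 'a set set set" where
  "closure_covers X =
     {\<U>. (\<forall>U\<in>\<U>. openin X U) \<and> (\<Union>U\<in>\<U>. X closure_of U) = topspace X}"

(* An ordinal is represented by a well-order r, its elements being the members of Field r.
   A strategy of player two in the game of length r answers at inning b on the basis of the
   moves (U c) of player one at all innings c \<le> b.  The partial play is coded as a function that
   is undefined outside of these innings, so the strategy cannot see any later move. *)
definition response ::
  "'i rel \<Rightarrow> ('i \<Rightarrow> ('i \<Rightarrow> 'b set) \<Rightarrow> 'b) \<Rightarrow> ('i \<Rightarrow> 'b set) \<Rightarrow> 'i \<Rightarrow> 'b" where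
  "response r \<sigma> U b = \<sigma> b (restrict U (under r b))"

definition winning_strategy_two ::
  "'i rel \<Rightarrow> 'b set set \<Rightarrow> 'b set set \<Rightarrow> ('i \<Rightarrow> ('i \<Rightarrow> 'b set) \<Rightarrow> 'b) \<Rightarrow> bool" where
  "winning_strategy_two r \<A> \<B> \<sigma> \<longleftrightarrow>
     (\<forall>U. (\<forall>b\<in>Field r. U b \<in> \<A>) \<longrightarrow>
        (\<forall>b\<in>Field r. response r \<sigma> U b \<in> U b) \<and> response r \<sigma> U ` Field r \<in> \<B>)"

definition two_wins_G1 :: "'i rel \<Rightarrow> 'b set set \<Rightarrow> 'b set set \<Rightarrow> bool" where
  "two_wins_G1 r \<A> \<B> \<longleftrightarrow> (\<exists>\<sigma>. winning_strategy_two r \<A> \<B> \<sigma>)"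

abbreviation omega1 :: "nat set rel" where
  "omega1 \<equiv> cardSuc natLeq"

definition closed_pseudocharacter_bound :: "'a topology \<Rightarrow> 'k rel \<Rightarrow> bool" where
  "closed_pseudocharacter_bound X \<kappa> \<longleftrightarrow>
     (\<forall>x\<in>topspace X. \<exists>\<V>. (\<forall>V\<in>\<V>. openin X V \<and> x \<in> V) \<and> |\<V>| \<le>o \<kappa> \<and>
        topspace X \<inter> (\<Inter>V\<in>\<V>. X closure_of V) = {x})"

(* \<kappa> is the closed pseudocharacter of X, up to order isomorphism.  The values can be taken on the
   type 'a set, because every family of subsets of X has at most that cardinality.  No such \<kappa> exists
   if some point is not an intersection of closures of its open neighbourhoods. *)
definition is_closed_pseudocharacter :: "'a topology \<Rightarrow> 'a set rel \<Rightarrow> bool" where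
  "is_closed_pseudocharacter X \<kappa> \<longleftrightarrow>
     Card_order \<kappa> \<and> closed_pseudocharacter_bound X \<kappa> \<and>
     (\<forall>\<kappa>'::'a set rel. Card_order \<kappa>' \<and> closed_pseudocharacter_bound X \<kappa>' \<longrightarrow> \<kappa> \<le>o \<kappa>')"

definition closed_pseudocharacter_le :: "'a topology \<Rightarrow> 'k rel \<Rightarrow> bool" where
  "closed_pseudocharacter_le X r \<longleftrightarrow> (\<exists>\<kappa>. is_closed_pseudocharacter X \<kappa> \<and> \<kappa> \<le>o r)"

lemma closed_pseudocharacter_bound_mono:
  assumes "closed_pseudocharacter_bound X \<kappa>" "\<kappa> \<le>o r"
  shows "closed_pseudocharacter_bound X r"
  unfolding closed_pseudocharacter_bound_def
proof
  fix x assume "x \<in> topspace X"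
  with assms(1) obtain \<V> where "\<forall>V\<in>\<V>. openin X V \<and> x \<in> V" "|\<V>| \<le>o \<kappa>"
      "topspace X \<inter> (\<Inter>V\<in>\<V>. X closure_of V) = {x}"
    unfolding closed_pseudocharacter_bound_def by blast
  then show "\<exists>\<V>. (\<forall>V\<in>\<V>. openin X V \<and> x \<in> V) \<and> |\<V>| \<le>o r \<and>
      topspace X \<inter> (\<Inter>V\<in>\<V>. X closure_of V) = {x}"
    by (intro exI[of _ \<V>] conjI ordLeq_transitive[OF _ assms(2)])
qed

lemma closed_pseudocharacter_le_iff:
  fixes X :: "'a topology" and r :: "'k rel"
  assumes "Card_order r"
  shows "closed_pseudocharacter_le X r \<longleftrightarrow> closed_pseudocharacter_bound X r"
proof
  assume "closed_pseudocharacter_le X r"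
  then show "closed_pseudocharacter_bound X r"
    unfolding closed_pseudocharacter_le_def is_closed_pseudocharacter_def
    by (elim exE conjE) (rule closed_pseudocharacter_bound_mono)
next
  assume b: "closed_pseudocharacter_bound X r"
  let ?U = "|UNIV :: 'a set set|"
  have "\<exists>\<kappa>::'a set rel. Card_order \<kappa> \<and> closed_pseudocharacter_bound X \<kappa> \<and> \<kappa> \<le>o r"
  proof (cases "r \<le>o ?U")
    case True
    then obtain p :: "'a set rel" where p: "(r, p) \<in> ordIso"
      unfolding internalize_ordLeq[of r ?U] by (elim exE conjE)
    have "Card_order p"
      using assms p by (rule Card_order_ordIso2)
    moreover have "closed_pseudocharacter_bound X p"
      using b ordIso_imp_ordLeq[OF p] by (rule closed_pseudocharacter_bound_mono)
    ultimately show ?thesis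
      using ordIso_imp_ordLeq[OF ordIso_symmetric[OF p]] by (intro exI[of _ p] conjI)
  next
    case False
    have "?U \<le>o r \<or> r \<le>o ?U"
      by (rule ordLeq_total[OF card_of_Well_order card_order_on_well_order_on[OF assms]])
    with False have "?U \<le>o r"
      by argo
    moreover have "closed_pseudocharacter_bound X ?U"
      unfolding closed_pseudocharacter_bound_def
    proof
      fix x assume "x \<in> topspace X"
      with b obtain \<V> where "\<forall>V\<in>\<V>. openin X V \<and> x \<in> V" "|\<V>| \<le>o r"
          "topspace X \<inter> (\<Inter>V\<in>\<V>. X closure_of V) = {x}"
        unfolding closed_pseudocharacter_bound_def by blast
      then show "\<exists>\<V>. (\<forall>V\<in>\<V>. openin X V \<and> x \<in> V) \<and> |\<V>| \<le>o ?U \<and>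
          topspace X \<inter> (\<Inter>V\<in>\<V>. X closure_of V) = {x}"
        by (intro exI[of _ \<V>] conjI card_of_mono1 subset_UNIV)
    qed
    ultimately show ?thesis
      by (intro exI[of _ ?U] conjI card_of_Card_order)
  qed
  then obtain \<kappa> :: "'a set rel" where
    k: "Card_order \<kappa>" "closed_pseudocharacter_bound X \<kappa>" "\<kappa> \<le>o r"
    by (elim exE conjE)
  define R where "R = {\<kappa>::'a set rel. Card_order \<kappa> \<and> closed_pseudocharacter_bound X \<kappa>}"
  have "\<kappa> \<in> R"
    unfolding R_def by (intro CollectI conjI k)
  moreover have "\<exists>\<mu>\<in>R. \<forall>\<mu>'\<in>R. \<mu> \<le>o \<mu>'"
  proof (rule exists_minim_Card_order)
    show "R \<noteq> {}" using \<open>\<kappa> \<in> R\<close> by blast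
    show "\<forall>r\<in>R. Card_order r" unfolding R_def by (intro ballI) (elim CollectE conjE)
  qed
  ultimately obtain \<mu> where m: "\<mu> \<in> R" "\<forall>\<mu>'\<in>R. \<mu> \<le>o \<mu>'" "\<mu> \<le>o \<kappa>"
    by (metis (no_types))
  then have "is_closed_pseudocharacter X \<mu>"
    unfolding is_closed_pseudocharacter_def R_def by (simp only: mem_Collect_eq Ball_def)
  moreover have "\<mu> \<le>o r"
    using m(3) k(3) by (rule ordLeq_transitive)
  ultimately show "closed_pseudocharacter_le X r"
    unfolding closed_pseudocharacter_le_def by (intro exI[of _ \<mu>] conjI)
qed

end

theory Submission
  imports Defs "HOL-Library.Countable_Set_Type"
begin

text \<open>
  The idea is to play against the winning strategy and to watch which points it can be forced to
  protect.  After any initial part of a play there is a point \<open>x\<close>, called focal here, all of whose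
  open neighbourhoods are possible next answers of player two: otherwise every point would have an
  open neighbourhood that is never the answer, and player one could offer the cover made of those
  neighbourhoods (\<open>focal_point_exists\<close>).

  Fix for each point \<open>x\<close> a sequence \<open>W x 0, W x 1, \<dots>\<close> of open neighbourhoods whose closures
  intersect in \<open>{x}\<close>.  A labelling \<open>f\<close> of the innings by natural numbers steers a play: at inning
  \<open>b\<close> player one plays a cover to which player two answers \<open>W x (f b)\<close>, where \<open>x\<close> is a
  focal point, selected once and for all for each history.  If some point \<open>y\<close> were never selected
  in any such play, then at each inning \<open>f b\<close> could be chosen so that \<open>y\<close> is outside the closure
  of \<open>W x (f b)\<close>, and player two would lose.  Hence every point of the space is selected at some
  inning of some steered play (\<open>focal_points_exhaust_space\<close>).  The argument works for a game along
  any well-order and for labels of any type.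

  The point selected at inning \<open>b\<close> depends only on the labels of earlier innings.  In a game of
  length \<open>\<omega>\<^sub>1\<close> these are countably many natural numbers, so at most continuum many points are selected
  (\<open>card_le_continuum_if_two_wins\<close>).

  A first-countable Hausdorff space has countable closed pseudocharacter because the closure of a
  neighbourhood of \<open>x\<close> that has a neighbourhood of \<open>y\<close> disjoint from it misses \<open>y\<close>.
\<close>

section \<open>Focal points of a winning strategy\<close>

text \<open>
  The innings from \<open>b\<close> on are all filled with \<open>\<U>\<close>.  Only the one at \<open>b\<close> affects the answer at \<open>b\<close>,
  and with this filling the answer is by construction independent of the values of \<open>H\<close> outside of
  the innings before \<open>b\<close>.
\<close>
definition reply ::
  "'i rel \<Rightarrow> ('i \<Rightarrow> ('i \<Rightarrow> 'b set) \<Rightarrow> 'b) \<Rightarrow> ('i \<Rightarrow> 'b set) \<Rightarrow> 'i \<Rightarrow> 'b set \<Rightarrow> 'b" where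
  "reply r \<sigma> H b \<U> = response r \<sigma> (\<lambda>c. if c \<in> underS r b then H c else \<U>) b"

lemma reply_cong:
  assumes "\<forall>c\<in>underS r b. H c = H' c"
  shows "reply r \<sigma> H b = reply r \<sigma> H' b"
proof
  fix \<U>
  have "(\<lambda>c. if c \<in> underS r b then H c else \<U>) = (\<lambda>c. if c \<in> underS r b then H' c else \<U>)"
    using assms by (auto simp: fun_eq_iff)
  then show "reply r \<sigma> H b \<U> = reply r \<sigma> H' b \<U>"
    unfolding reply_def by simp
qed

lemma response_eq_reply: "response r \<sigma> U b = reply r \<sigma> U b (U b)"
proof -
  have "restrict U (under r b) = restrict (\<lambda>c. if c \<in> underS r b then U c else U b) (under r b)"
    by (auto simp: restrict_def under_def underS_def fun_eq_iff)
  then show ?thesis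
    unfolding reply_def response_def by simp
qed

lemma reply_in_cover:
  assumes "winning_strategy_two r \<A> \<B> \<sigma>" "b \<in> Field r"
    and "\<forall>c\<in>underS r b. H c \<in> \<A>" and "\<U> \<in> \<A>"
  shows "reply r \<sigma> H b \<U> \<in> \<U>"
proof -
  define U where "U = (\<lambda>c. if c \<in> underS r b then H c else \<U>)"
  have "\<forall>c\<in>Field r. U c \<in> \<A>"
    using assms(3,4) by (simp add: U_def)
  then have "response r \<sigma> U b \<in> U b"
    using assms(1,2) unfolding winning_strategy_two_def by blast
  then show ?thesis
    unfolding reply_def U_def by (simp add: underS_def)
qed

definition focal ::
  "'a topology \<Rightarrow> 'i rel \<Rightarrow> ('i \<Rightarrow> ('i \<Rightarrow> 'a set set) \<Rightarrow> 'a set) \<Rightarrow> ('i \<Rightarrow> 'a set set) \<Rightarrow> 'i \<Rightarrow> 'a \<Rightarrow> bool"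
  where "focal X r \<sigma> H b x \<longleftrightarrow>
    x \<in> topspace X \<and> (\<forall>V. openin X V \<and> x \<in> V \<longrightarrow> V \<in> reply r \<sigma> H b ` open_covers X)"

text \<open>
  If every point \<open>x\<close> had an open neighbourhood \<open>N x\<close> that is never the answer at inning \<open>b\<close>, player
  two could not answer the cover by the sets \<open>N x\<close>.
\<close>
lemma focal_point_exists:
  assumes "winning_strategy_two r (open_covers X) \<B> \<sigma>" "b \<in> Field r"
    and "\<forall>c\<in>underS r b. H c \<in> open_covers X"
  shows "\<exists>x. focal X r \<sigma> H b x"
proof (rule ccontr)
  assume "\<nexists>x. focal X r \<sigma> H b x"
  then have "\<forall>x\<in>topspace X. \<exists>V. openin X V \<and> x \<in> V \<and> V \<notin> reply r \<sigma> H b ` open_covers X"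
    unfolding focal_def by blast
  then obtain N where N: "\<And>x. x \<in> topspace X \<Longrightarrow>
      openin X (N x) \<and> x \<in> N x \<and> N x \<notin> reply r \<sigma> H b ` open_covers X"
    by metis
  have cover: "N ` topspace X \<in> open_covers X"
    using N openin_subset unfolding open_covers_def by blast
  from reply_in_cover[OF assms cover] show False
    using N cover by blast
qed

section \<open>Plays steered by a labelling of the innings\<close>

definition focal_point ::
  "'a topology \<Rightarrow> 'i rel \<Rightarrow> ('i \<Rightarrow> ('i \<Rightarrow> 'a set set) \<Rightarrow> 'a set) \<Rightarrow> ('i \<Rightarrow> 'a set set) \<Rightarrow> 'i \<Rightarrow> 'a"
  where "focal_point X r \<sigma> H b = (SOME x. focal X r \<sigma> H b x)"

definition forcing_cover ::
  "'a topology \<Rightarrow> 'i rel \<Rightarrow> ('i \<Rightarrow> ('i \<Rightarrow> 'a set set) \<Rightarrow> 'a set) \<Rightarrow> ('i \<Rightarrow> 'a set set) \<Rightarrow> 'i \<Rightarrow>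
    'a set \<Rightarrow> 'a set set"
  where "forcing_cover X r \<sigma> H b V = (SOME \<U>. \<U> \<in> open_covers X \<and> reply r \<sigma> H b \<U> = V)"

definition steered_play ::
  "'a topology \<Rightarrow> 'i rel \<Rightarrow> ('i \<Rightarrow> ('i \<Rightarrow> 'a set set) \<Rightarrow> 'a set) \<Rightarrow> ('a \<Rightarrow> 'k \<Rightarrow> 'a set) \<Rightarrow>
    ('i \<Rightarrow> 'k) \<Rightarrow> 'i \<Rightarrow> 'a set set"
  where "steered_play X r \<sigma> W f =
    wo_rel.worec r (\<lambda>H b. forcing_cover X r \<sigma> H b (W (focal_point X r \<sigma> H b) (f b)))"

lemma focal_point_cong:
  assumes "\<forall>c\<in>underS r b. H c = H' c"
  shows "focal_point X r \<sigma> H b = focal_point X r \<sigma> H' b"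
  unfolding focal_point_def focal_def using reply_cong[OF assms] by simp

lemma forcing_cover_cong:
  assumes "\<forall>c\<in>underS r b. H c = H' c"
  shows "forcing_cover X r \<sigma> H b = forcing_cover X r \<sigma> H' b"
  unfolding forcing_cover_def using reply_cong[OF assms] by metis

lemma steered_play_unfold:
  assumes "Well_order r"
  shows "steered_play X r \<sigma> W f b = forcing_cover X r \<sigma> (steered_play X r \<sigma> W f) b
           (W (focal_point X r \<sigma> (steered_play X r \<sigma> W f) b) (f b))"
proof -
  have wo: "wo_rel r" using assms by (simp add: wo_rel_def)
  have "wo_rel.adm_wo r (\<lambda>H b. forcing_cover X r \<sigma> H b (W (focal_point X r \<sigma> H b) (f b)))"
    unfolding wo_rel.adm_wo_def[OF wo] by (metis focal_point_cong forcing_cover_cong)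
  from wo_rel.worec_fixpoint[OF wo this] show ?thesis
    unfolding steered_play_def by metis
qed

definition steered_point ::
  "'a topology \<Rightarrow> 'i rel \<Rightarrow> ('i \<Rightarrow> ('i \<Rightarrow> 'a set set) \<Rightarrow> 'a set) \<Rightarrow> ('a \<Rightarrow> 'k \<Rightarrow> 'a set) \<Rightarrow>
    ('i \<Rightarrow> 'k) \<Rightarrow> 'i \<Rightarrow> 'a"
  where "steered_point X r \<sigma> W f b = focal_point X r \<sigma> (steered_play X r \<sigma> W f) b"

text \<open>
  The label at \<open>b\<close> is only used after the point at \<open>b\<close> has been reached, so this point is determined
  by the labels of strictly earlier innings.
\<close>
lemma steered_point_cong:
  assumes "Well_order r" and "\<forall>c\<in>underS r b. f c = g c"
  shows "steered_point X r \<sigma> W f b = steered_point X r \<sigma> W g b"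
proof -
  have wo: "wo_rel r" using assms(1) by (simp add: wo_rel_def)
  have "c \<in> underS r b \<Longrightarrow> steered_play X r \<sigma> W f c = steered_play X r \<sigma> W g c" for c
  proof (induction c rule: wo_rel.well_order_induct[OF wo])
    case (1 c)
    have prev: "\<forall>d\<in>underS r c. steered_play X r \<sigma> W f d = steered_play X r \<sigma> W g d"
    proof
      fix d assume d: "d \<in> underS r c"
      then have "d \<in> underS r b"
        using 1(2) wo_rel.TRANS[OF wo] wo_rel.ANTISYM[OF wo] unfolding underS_def trans_def antisym_def by blast
      then show "steered_play X r \<sigma> W f d = steered_play X r \<sigma> W g d"
        using 1(1) d by (simp add: underS_def)
    qed
    show ?case
      using focal_point_cong[OF prev, where X=X and \<sigma>=\<sigma>]
        forcing_cover_cong[OF prev, where X=X and \<sigma>=\<sigma>] bspec[OF assms(2) 1(2)]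
        steered_play_unfold[OF assms(1), of X \<sigma> W f c]
        steered_play_unfold[OF assms(1), of X \<sigma> W g c]
      by simp
  qed
  then show ?thesis
    unfolding steered_point_def by (intro focal_point_cong ballI)
qed

text \<open>
  The chosen points and covers have their intended properties only after a legal history, because
  nothing is known about the answers of the strategy otherwise.  So legality of the play comes
  first, by induction on the innings, and the rest follows from it.
\<close>
lemma steered_play_legal:
  assumes win: "winning_strategy_two r (open_covers X) \<B> \<sigma>" and r: "Well_order r"
    and W: "\<forall>x\<in>topspace X. \<forall>k. openin X (W x k) \<and> x \<in> W x k"
    and b: "b \<in> Field r"
  shows "steered_point X r \<sigma> W f b \<in> topspace X"
    and "steered_play X r \<sigma> W f b \<in> open_covers X"
    and "response r \<sigma> (steered_play X r \<sigma> W f) b = W (steered_point X r \<sigma> W f b) (f b)"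
proof -
  have wo: "wo_rel r" using r by (simp add: wo_rel_def)
  define U where "U = steered_play X r \<sigma> W f"
  have step: "focal_point X r \<sigma> U b \<in> topspace X \<and> U b \<in> open_covers X \<and>
      reply r \<sigma> U b (U b) = W (focal_point X r \<sigma> U b) (f b)"
    if "b \<in> Field r" "\<forall>c\<in>underS r b. U c \<in> open_covers X" for b
  proof -
    let ?x = "focal_point X r \<sigma> U b"
    have "focal X r \<sigma> U b ?x"
      unfolding focal_point_def using focal_point_exists[OF win that] by (rule someI_ex)
    then have x: "?x \<in> topspace X"
      and all: "\<forall>V. openin X V \<and> ?x \<in> V \<longrightarrow> V \<in> reply r \<sigma> U b ` open_covers X"
      unfolding focal_def by simp_all
    from W x have "openin X (W ?x (f b)) \<and> ?x \<in> W ?x (f b)"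
      by simp
    with all have "W ?x (f b) \<in> reply r \<sigma> U b ` open_covers X"
      by simp
    then have "\<exists>\<U>. \<U> \<in> open_covers X \<and> reply r \<sigma> U b \<U> = W ?x (f b)"
      by auto
    then have "forcing_cover X r \<sigma> U b (W ?x (f b)) \<in> open_covers X \<and>
        reply r \<sigma> U b (forcing_cover X r \<sigma> U b (W ?x (f b))) = W ?x (f b)"
      unfolding forcing_cover_def by (rule someI_ex)
    moreover have "U b = forcing_cover X r \<sigma> U b (W ?x (f b))"
      unfolding U_def by (rule steered_play_unfold[OF r])
    ultimately show ?thesis
      using x by metis
  qed
  have legal: "b \<in> Field r \<Longrightarrow> U b \<in> open_covers X" for b
  proof (induction b rule: wo_rel.well_order_induct[OF wo])
    case (1 b)
    then have "\<forall>c\<in>underS r b. U c \<in> open_covers X"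
      by (auto simp: underS_def Field_def)
    with step 1(2) show ?case by blast
  qed
  moreover have "underS r b \<subseteq> Field r"
    by (auto simp: underS_def Field_def)
  ultimately show "steered_point X r \<sigma> W f b \<in> topspace X"
    and "steered_play X r \<sigma> W f b \<in> open_covers X"
    and "response r \<sigma> (steered_play X r \<sigma> W f) b = W (steered_point X r \<sigma> W f b) (f b)"
    using step[OF b] unfolding response_eq_reply steered_point_def U_def[symmetric] by blast+
qed

text \<open>
  A point that is never reached could be kept outside the closures of all answers: at each inning
  the label is chosen so that the closure of the forced answer misses it.  These labels are
  defined by recursion, which is possible because the point reached at an inning depends only on
  the labels before it.
\<close>
lemma focal_points_exhaust_space:
  fixes r :: "'i rel" and W :: "'a \<Rightarrow> 'k \<Rightarrow> 'a set"
  assumes win: "winning_strategy_two r (open_covers X) (closure_covers X) \<sigma>" and r: "Well_order r"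
    and W: "\<forall>x\<in>topspace X. \<forall>k. openin X (W x k) \<and> x \<in> W x k"
    and sep: "\<forall>x\<in>topspace X. \<forall>y\<in>topspace X. x \<noteq> y \<longrightarrow> (\<exists>k. y \<notin> X closure_of W x k)"
    and y: "y \<in> topspace X"
  shows "\<exists>f. \<exists>b\<in>Field r. steered_point X r \<sigma> W f b = y"
proof (rule ccontr)
  assume "\<not> ?thesis"
  then have avoid: "steered_point X r \<sigma> W f b \<noteq> y" if "b \<in> Field r" for f b
    using that by blast
  have wo: "wo_rel r" using r by (simp add: wo_rel_def)
  define F where "F = (\<lambda>f b. SOME k. y \<notin> X closure_of W (steered_point X r \<sigma> W f b) k)"
  define f where "f = wo_rel.worec r F"
  have "wo_rel.adm_wo r F"
    unfolding wo_rel.adm_wo_def[OF wo]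
  proof (intro allI impI)
    fix f g :: "'i \<Rightarrow> 'k" and b
    assume "\<forall>c\<in>underS r b. f c = g c"
    from steered_point_cong[OF r this, of X \<sigma> W] show "F f b = F g b"
      unfolding F_def by (simp only:)
  qed
  then have f: "f = F f"
    unfolding f_def by (rule wo_rel.worec_fixpoint[OF wo])
  define U where "U = steered_play X r \<sigma> W f"
  note legal = steered_play_legal[OF win r W, where f=f, folded U_def]
  have miss: "y \<notin> X closure_of response r \<sigma> U b" if b: "b \<in> Field r" for b
  proof -
    have "\<exists>k. y \<notin> X closure_of W (steered_point X r \<sigma> W f b) k"
      using sep legal(1)[OF b] avoid[OF b] y by blast
    then have "y \<notin> X closure_of W (steered_point X r \<sigma> W f b) (F f b)"
      unfolding F_def by (rule someI_ex)
    then have "y \<notin> X closure_of W (steered_point X r \<sigma> W f b) (f b)"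
      using fun_cong[OF f[symmetric], of b] by simp
    with legal(3)[OF b] show ?thesis by simp
  qed
  have "response r \<sigma> U ` Field r \<in> closure_covers X"
    using win legal(2) unfolding winning_strategy_two_def by (metis (no_types))
  with y miss show False
    unfolding closure_covers_def by blast
qed

section \<open>Counting\<close>

text \<open>
  A countable family of neighbourhoods may be empty, in a space with one point; adding the whole
  space to the family allows enumerating it by the natural numbers.
\<close>
lemma closed_pseudocharacter_sequences:
  assumes "closed_pseudocharacter_bound X natLeq"
  obtains W :: "'a \<Rightarrow> nat \<Rightarrow> 'a set" where
    "\<forall>x\<in>topspace X. \<forall>k. openin X (W x k) \<and> x \<in> W x k"
    "\<forall>x\<in>topspace X. \<forall>y\<in>topspace X. x \<noteq> y \<longrightarrow> (\<exists>k. y \<notin> X closure_of W x k)"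
proof -
  have "\<exists>w :: nat \<Rightarrow> 'a set. (\<forall>k. openin X (w k) \<and> x \<in> w k) \<and>
      (\<forall>y\<in>topspace X. x \<noteq> y \<longrightarrow> (\<exists>k. y \<notin> X closure_of w k))" if x: "x \<in> topspace X" for x
  proof -
    from assms x obtain \<V> where V: "\<forall>V\<in>\<V>. openin X V \<and> x \<in> V" "countable \<V>"
        "topspace X \<inter> (\<Inter>V\<in>\<V>. X closure_of V) = {x}"
      unfolding closed_pseudocharacter_bound_def countable_card_le_natLeq by blast
    let ?w = "from_nat_into (insert (topspace X) \<V>)"
    have ran: "range ?w = insert (topspace X) \<V>"
      using V(2) by (simp add: range_from_nat_into)
    then have "openin X (?w k) \<and> x \<in> ?w k" for k
      using V(1) x rangeI[of ?w k] by auto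
    moreover have "\<exists>k. y \<notin> X closure_of ?w k" if y: "y \<in> topspace X" "x \<noteq> y" for y
    proof -
      have "y \<notin> topspace X \<inter> (\<Inter>V\<in>\<V>. X closure_of V)"
        unfolding V(3) using y(2) by simp
      then obtain V where "V \<in> \<V>" "y \<notin> X closure_of V"
        using y(1) by auto
      with ran show ?thesis by (metis insertI2 rangeE)
    qed
    ultimately show ?thesis by blast
  qed
  then have "\<exists>W :: 'a \<Rightarrow> nat \<Rightarrow> 'a set. \<forall>x\<in>topspace X. (\<forall>k. openin X (W x k) \<and> x \<in> W x k) \<and>
      (\<forall>y\<in>topspace X. x \<noteq> y \<longrightarrow> (\<exists>k. y \<notin> X closure_of W x k))"
    by (intro bchoice) blast
  then show thesis
    using that by metis
qed

lemma countable_underS_omega1: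
  assumes "b \<in> Field omega1"
  shows "countable (underS omega1 b)"
proof -
  have "|underS omega1 b| <o omega1"
    using assms by (intro card_of_underS cardSuc_Card_order natLeq_Card_order)
  then show ?thesis
    unfolding countable_card_le_natLeq
    using cardSuc_ordLeq_ordLess[OF natLeq_Card_order card_of_Card_order] by blast
qed

text \<open>
  Labellings of a countable set are coded as sets of natural numbers, by their graphs.  Only that
  every labelling has a code matters, so sets that are no graph may decode to anything.
\<close>
definition decode :: "'i set \<Rightarrow> nat set \<Rightarrow> 'i \<Rightarrow> nat" where
  "decode A S a = (THE n. prod_encode (to_nat_on A a, n) \<in> S)"

lemma decode_surj:
  assumes "countable A"
  shows "\<exists>S. \<forall>a\<in>A. decode A S a = f a"
proof (intro exI ballI)
  fix a assume "a \<in> A"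
  then show "decode A ((\<lambda>a. prod_encode (to_nat_on A a, f a)) ` A) a = f a"
    using assms unfolding decode_def by (intro the_equality) auto
qed

lemma card_nat_sets_Times: "|UNIV :: (nat set \<times> nat set) set| \<le>o ctwo ^c natLeq"
proof -
  have "infinite (UNIV :: nat set set)"
    by (simp add: Finite_Set.finite_set)
  then have "|UNIV \<times> UNIV :: (nat set \<times> nat set) set| =o |UNIV :: nat set set|"
    by (rule card_of_Times_same_infinite)
  moreover have "|UNIV :: nat set set| =o ctwo ^c natLeq"
    using card_of_Pow_Func[of "UNIV :: nat set"]
    by (simp add: cexp_def ctwo_def Field_natLeq Field_card_of)
  ultimately show ?thesis
    using ordIso_transitive ordIso_imp_ordLeq by (metis UNIV_Times_UNIV)
qed

text \<open>
  The innings of a game of length \<open>\<omega>\<^sub>1\<close> are themselves sets of natural numbers.  So a point reached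
  in a steered play is coded by two such sets, its inning and the code of the labels before it.
\<close>
lemma card_le_continuum_if_two_wins:
  assumes "closed_pseudocharacter_bound X natLeq"
    and "two_wins_G1 omega1 (open_covers X) (closure_covers X)"
  shows "|topspace X| \<le>o ctwo ^c natLeq"
proof -
  obtain W :: "'a \<Rightarrow> nat \<Rightarrow> 'a set" where W:
    "\<forall>x\<in>topspace X. \<forall>k. openin X (W x k) \<and> x \<in> W x k"
    "\<forall>x\<in>topspace X. \<forall>y\<in>topspace X. x \<noteq> y \<longrightarrow> (\<exists>k. y \<notin> X closure_of W x k)"
    using closed_pseudocharacter_sequences[OF assms(1)] by blast
  obtain \<sigma> where win: "winning_strategy_two omega1 (open_covers X) (closure_covers X) \<sigma>"
    using assms(2) unfolding two_wins_G1_def by blast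
  have r: "Well_order omega1"
    using cardSuc_Card_order[OF natLeq_Card_order] by (rule card_order_on_well_order_on)
  let ?point = "\<lambda>(b, S). steered_point X omega1 \<sigma> W (decode (underS omega1 b) S) b"
  have "topspace X \<subseteq> range ?point"
  proof
    fix y assume "y \<in> topspace X"
    then obtain f b where b: "b \<in> Field omega1" and y: "steered_point X omega1 \<sigma> W f b = y"
      using focal_points_exhaust_space[OF win r W] by blast
    obtain S where "\<forall>c\<in>underS omega1 b. decode (underS omega1 b) S c = f c"
      using decode_surj[OF countable_underS_omega1[OF b]] by blast
    then have "?point (b, S) = y"
      using steered_point_cong[OF r] y by (metis (no_types, lifting) case_prod_conv)
    then show "y \<in> range ?point" by blast
  qed
  then have "|topspace X| \<le>o |UNIV :: (nat set \<times> nat set) set|"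
    by (rule surj_imp_ordLeq)
  then show ?thesis
    using card_nat_sets_Times by (rule ordLeq_transitive)
qed

section \<open>First-countable Hausdorff spaces\<close>

lemma first_countable_Hausdorff_closed_pseudocharacter:
  assumes "first_countable X" "Hausdorff_space X"
  shows "closed_pseudocharacter_bound X natLeq"
  unfolding closed_pseudocharacter_bound_def
proof
  fix x assume x: "x \<in> topspace X"
  with assms(1) obtain \<B> where B: "countable \<B>" "\<forall>V\<in>\<B>. openin X V"
      "\<And>U. openin X U \<Longrightarrow> x \<in> U \<Longrightarrow> \<exists>V\<in>\<B>. x \<in> V \<and> V \<subseteq> U"
    unfolding first_countable_def by metis
  let ?V = "{V \<in> \<B>. x \<in> V}"
  have "\<exists>V\<in>?V. y \<notin> X closure_of V" if y: "y \<in> topspace X" "y \<noteq> x" for y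
  proof -
    obtain U U' where U: "openin X U" "openin X U'" "x \<in> U" "y \<in> U'" "disjnt U U'"
      using assms(2) x y unfolding Hausdorff_space_def by metis
    obtain V where V: "V \<in> \<B>" "x \<in> V" "V \<subseteq> U"
      using B(3) U(1,3) by blast
    have "U' \<inter> X closure_of V = {}"
      using openin_Int_closure_of_eq_empty[OF U(2)] U(5) V(3) unfolding disjnt_def by blast
    with U(4) V show ?thesis by blast
  qed
  moreover have "x \<in> X closure_of V" if "V \<in> ?V" for V
    using that x by (auto simp: in_closure_of)
  ultimately have "topspace X \<inter> (\<Inter>V\<in>?V. X closure_of V) = {x}"
    using x by blast
  moreover have "|?V| \<le>o natLeq"
    using B(1) unfolding countable_card_le_natLeq[symmetric] by simp
  ultimately show "\<exists>\<V>. (\<forall>V\<in>\<V>. openin X V \<and> x \<in> V) \<and> |\<V>| \<le>o natLeq \<and>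
      topspace X \<inter> (\<Inter>V\<in>\<V>. X closure_of V) = {x}"
    using B(2) by (intro exI[of _ ?V]) blast
qed

theorem theorem2p1:
  fixes X :: "'a topology"
  shows "(closed_pseudocharacter_le X natLeq \<and>
            two_wins_G1 omega1 (open_covers X) (closure_covers X)
            \<longrightarrow> |topspace X| \<le>o ctwo ^c natLeq) \<and>
         (first_countable X \<and> Hausdorff_space X \<longrightarrow> closed_pseudocharacter_le X natLeq)"
  unfolding closed_pseudocharacter_le_iff[OF natLeq_Card_order]
  using card_le_continuum_if_two_wins first_countable_Hausdorff_closed_pseudocharacter by blast

end
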